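(* Let $d\ge 3$. Every connected simplicial $d$-manifold (possibly with boundary) has a facet cycle, unless it is a single $d$-simplex.
   Context: A simplicial $d$-manifold is a finite simplicial complex homeomorphic to a $d$-dimensional manifold, possibly with boundary; its $d$-simplices are called facets. The (vertex-facet) incidence graph has a node for every vertex and every facet, with an arc $(v,f)$ whenever $v$ is a vertex of $f$. A facet cycle is a closed trail $(v_0,f_1,v_1,\dots,f_k,v_k)$ with $v_k=v_0$ in the incidence graph (no arc repeated) that passes through every facet node exactly once (vertex nodes may repeat). *)

theory Defs
  imports "HOL-Analysis.Analysis"
begin

definition simplicial_complex :: "'v set set \<Rightarrow> bool" where
  "simplicial_complex K \<longleftrightarrow> finite K \<and> (\<forall>\<sigma>\<in>K. finite \<sigma> \<and> \<sigma> \<noteq> {}) \<and>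
     (\<forall>\<sigma>\<in>K. \<forall>\<tau>. \<tau> \<subseteq> \<sigma> \<and> \<tau> \<noteq> {} \<longrightarrow> \<tau> \<in> K)"

definition cvertices :: "'v set set \<Rightarrow> 'v set" where
  "cvertices K = {v. {v} \<in> K}"

text \<open>Standard geometric realization: points are barycentric coordinate functions,
  the union of the closed simplices spanned by the standard basis vectors.\<close>
definition realization :: "'v set set \<Rightarrow> ('v \<Rightarrow> real) set" where
  "realization K = {x. \<exists>\<sigma>\<in>K. (\<forall>v. 0 \<le> x v) \<and> (\<forall>v. v \<notin> \<sigma> \<longrightarrow> x v = 0) \<and> sum x \<sigma> = 1}"

definition realization_top :: "'v set set \<Rightarrow> ('v \<Rightarrow> real) topology" where
  "realization_top K = subtopology (powertop_real UNIV) (realization K)"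

definition half_space :: "nat \<Rightarrow> (nat \<Rightarrow> real) topology" where
  "half_space d = subtopology (Euclidean_space d) {y. 0 \<le> y 0}"

definition manifold_with_boundary :: "nat \<Rightarrow> 'a topology \<Rightarrow> bool" where
  "manifold_with_boundary d X \<longleftrightarrow> Hausdorff_space X \<and> second_countable X \<and>
     (\<forall>x\<in>topspace X. \<exists>U V. openin X U \<and> x \<in> U \<and> openin (half_space d) V \<and>
        (subtopology X U) homeomorphic_space (subtopology (half_space d) V))"

definition simplicial_manifold :: "nat \<Rightarrow> 'v set set \<Rightarrow> bool" where
  "simplicial_manifold d K \<longleftrightarrow> simplicial_complex K \<and> manifold_with_boundary d (realization_top K)"

definition facets :: "nat \<Rightarrow> 'v set set \<Rightarrow> 'v set set" where
  "facets d K = {\<sigma>\<in>K. card \<sigma> = d + 1}"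

definition single_simplex :: "nat \<Rightarrow> 'v set set \<Rightarrow> bool" where
  "single_simplex d K \<longleftrightarrow> (\<exists>\<sigma>. finite \<sigma> \<and> card \<sigma> = d + 1 \<and> K = {\<tau>. \<tau> \<subseteq> \<sigma> \<and> \<tau> \<noteq> {}})"

text \<open>Facet cycle: closed trail v_0,f_1,v_1,...,f_k,v_k=v_0 in the vertex-facet incidence
  graph, no arc repeated, each facet visited exactly once. Here vs = [v_0,...,v_k] and
  fs = [f_1,...,f_k]; the arc between vertex v and facet f is represented by (v,f).\<close>
definition facet_cycle :: "nat \<Rightarrow> 'v set set \<Rightarrow> 'v list \<Rightarrow> 'v set list \<Rightarrow> bool" where
  "facet_cycle d K vs fs \<longleftrightarrow>
     length vs = length fs + 1 \<and> vs ! length fs = vs ! 0 \<and>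
     set vs \<subseteq> cvertices K \<and>
     distinct fs \<and> set fs = facets d K \<and>
     (\<forall>i < length fs. vs ! i \<in> fs ! i \<and> vs ! (i+1) \<in> fs ! i) \<and>
     distinct (concat (map (\<lambda>i. [(vs ! i, fs ! i), (vs ! (i+1), fs ! i)]) [0..<length fs]))"

end

theory Submission
  imports "HOL-Homology.Invariance_of_Domain" Defs
begin

text \<open>
  By invariance of domain every maximal simplex is a facet. A closed subset of \<open>d\<close>-space that is
  homeomorphic to a proper closed subset of \<open>(d-1)\<close>-space does not separate \<open>d\<close>-space. Hence the
  simplices of dimension at most \<open>d - 2\<close> can be removed from the manifold one after the other
  without disconnecting it, and so any two facets are joined by a chain of facets in which
  neighbours share \<open>d\<close> vertices.
  Starting from a cycle through two adjacent facets, the other facets are inserted one at a time: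
  if \<open>g\<close> is adjacent to a facet \<open>f\<close> that the cycle traverses from \<open>a\<close> to \<open>b\<close>, then \<open>g\<close> contains
  \<open>a\<close> or \<open>b\<close>, and as \<open>d \<ge> 3\<close> there is a common vertex of \<open>f\<close> and \<open>g\<close> other than \<open>a\<close>, \<open>b\<close>
  through which to make the detour.
\<close>

section \<open>Sets that do not separate a manifold\<close>

lemma Euclidean_space_eq_top_of_set: "Euclidean_space n = top_of_set {x. \<forall>i\<ge>n. x i = 0}"
  by (simp add: Euclidean_space_def euclidean_product_topology)

lemma continuous_on_coordinate [continuous_intros]:
  fixes S :: "('i \<Rightarrow> 'b::topological_space) set"
  shows "continuous_on S (\<lambda>x. x i)"
  by (rule continuous_on_product_then_coordinatewise) (rule continuous_on_id)

lemma continuous_on_fun_upd: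
  fixes x :: "'i \<Rightarrow> 'b::topological_space"
  shows "continuous_on S (\<lambda>t. x(i := t))"
proof (rule continuous_on_coordinatewise_then_product)
  show "continuous_on S (\<lambda>t. (x(i := t)) j)" for j by (cases "j = i") auto
qed

text \<open>\<open>T\<close> lies in the hyperplane where coordinate \<open>n\<close> vanishes, so
  the open half-space misses it. A segment from a point of the open half-space to any point of the
  closed one stays in the open half-space up to its last point. The sign of \<open>s\<close> selects
  the side.\<close>

lemma path_connectedin_closed_half_space_complement:
  assumes "s \<noteq> 0" and T: "T \<subseteq> topspace (Euclidean_space n)"
  shows "path_connectedin (Euclidean_space (Suc n)) {x \<in> topspace (Euclidean_space (Suc n)) - T. 0 \<le> s * x n}"
proof (rule lemma_iod)
  let ?S = "{x \<in> topspace (Euclidean_space (Suc n)). 0 < s * x n}"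
  show "?S \<subseteq> {x \<in> topspace (Euclidean_space (Suc n)) - T. 0 \<le> s * x n}"
    using T by (auto simp: topspace_Euclidean_space)
  have "(\<lambda>i. if i = n then s else 0) \<in> ?S"
    using \<open>s \<noteq> 0\<close> by (auto simp: topspace_Euclidean_space) (auto simp: zero_less_mult_iff linorder_neq_iff)
  then show "?S \<noteq> {}" by blast
  fix a b :: "nat \<Rightarrow> real" and u :: real
  assume a: "a \<in> ?S" and b: "b \<in> {x \<in> topspace (Euclidean_space (Suc n)) - T. 0 \<le> s * x n}"
    and u: "0 < u" "u < 1"
  have "0 < (1 - u) * (s * a n) + u * (s * b n)"
  proof (rule add_pos_nonneg)
    show "0 < (1 - u) * (s * a n)" by (rule mult_pos_pos) (use a u in auto)
    show "0 \<le> u * (s * b n)" by (rule mult_nonneg_nonneg) (use b u in auto)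
  qed
  then show "(\<lambda>i. (1 - u) * a i + u * b i) \<in> ?S"
    using a b by (auto simp: topspace_Euclidean_space algebra_simps)
qed auto

text \<open>Whether a closed set separates Euclidean space depends only on its homeomorphism type,
  so \<open>S\<close> may be replaced by \<open>T\<close>, which lies in a hyperplane. The
  complement of \<open>T\<close> is the union of two closed half-spaces minus \<open>T\<close>,
  which are connected and share a point of the hyperplane. If \<open>S\<close> were the whole space,
  invariance of dimension would make \<open>T\<close> the whole space as well.\<close>

lemma Euclidean_complement_of_lower_dimensional:
  assumes S: "closedin (Euclidean_space (Suc n)) S"
    and T: "closedin (Euclidean_space n) T" "T \<noteq> topspace (Euclidean_space n)"
    and hom: "subtopology (Euclidean_space (Suc n)) S homeomorphic_space subtopology (Euclidean_space n) T"
  shows "connectedin (Euclidean_space (Suc n)) (topspace (Euclidean_space (Suc n)) - S)"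
    and "S \<noteq> topspace (Euclidean_space (Suc n))"
proof -
  have sub: "T \<subseteq> topspace (Euclidean_space n)" using T closedin_subset by blast
  then have sub': "T \<subseteq> topspace (Euclidean_space (Suc n))"
    by (meson le_Suc_eq order_refl order_trans subset_Euclidean_space)
  have eq: "subtopology (Euclidean_space n) T = subtopology (Euclidean_space (Suc n)) T"
    using sub sub' by (simp add: Euclidean_space_def subtopology_subtopology Int_absorb1)
  have clo: "closedin (Euclidean_space (Suc n)) T"
    using T(1) sub' by (simp add: closedin_Euclidean_space_iff)
  let ?H = "\<lambda>s. {x \<in> topspace (Euclidean_space (Suc n)) - T. 0 \<le> s * x n}"
  obtain p where "p \<in> topspace (Euclidean_space n)" "p \<notin> T" using T sub by auto
  then have "p \<in> ?H 1 \<inter> ?H (-1)" by (auto simp: topspace_Euclidean_space)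
  then have "connectedin (Euclidean_space (Suc n)) (?H 1 \<union> ?H (-1))"
    using path_connectedin_closed_half_space_complement[OF _ sub, of 1]
      path_connectedin_closed_half_space_complement[OF _ sub, of "-1"]
    by (intro connectedin_Un path_connectedin_imp_connectedin) auto
  moreover have "?H 1 \<union> ?H (-1) = topspace (Euclidean_space (Suc n)) - T" by auto
  ultimately show "connectedin (Euclidean_space (Suc n)) (topspace (Euclidean_space (Suc n)) - S)"
    using connected_in_Euclidean_complements[OF S clo] hom eq by simp
  show "S \<noteq> topspace (Euclidean_space (Suc n))"
  proof
    assume "S = topspace (Euclidean_space (Suc n))"
    have "subtopology (Euclidean_space (Suc n)) T homeomorphic_space Euclidean_space (Suc n)"
      using hom unfolding eq \<open>S = _\<close> subtopology_topspace by (rule homeomorphic_space_sym[THEN iffD1])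
    then have "T = topspace (Euclidean_space (Suc n))"
      using invariance_of_dimension_closedin_Euclidean_space[OF clo] by simp
    then show False using sub by simp
  qed
qed

text \<open>Boundary points have no Euclidean neighbourhood, but they have small neighbourhoods with a
  dense Euclidean open subset. This property passes to open subsets, and it suffices for
  separation arguments.\<close>
definition dense_charts :: "nat \<Rightarrow> 'a topology \<Rightarrow> bool" where
  "dense_charts d X \<longleftrightarrow> (\<forall>S x. openin X S \<and> x \<in> S \<longrightarrow>
     (\<exists>W W'. openin X W \<and> openin X W' \<and> x \<in> W \<and> W' \<subseteq> W \<and> W \<subseteq> S \<and> W \<subseteq> X closure_of W' \<and>
        subtopology X W' homeomorphic_space Euclidean_space d))"

lemma dense_charts_open_subset:
  assumes "dense_charts d X" and "openin X U"
  shows "dense_charts d (subtopology X U)"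
  unfolding dense_charts_def
proof (intro allI impI)
  fix S x assume S: "openin (subtopology X U) S \<and> x \<in> S"
  then have "openin X S" "S \<subseteq> U"
    using assms(2) by (auto simp: openin_open_subtopology)
  then obtain W W' where W: "openin X W" "openin X W'" "x \<in> W" "W' \<subseteq> W" "W \<subseteq> S"
      "W \<subseteq> X closure_of W'" "subtopology X W' homeomorphic_space Euclidean_space d"
    using assms(1) S unfolding dense_charts_def by meson
  have "openin (subtopology X U) W" "openin (subtopology X U) W'"
    unfolding openin_open_subtopology[OF assms(2)] using W \<open>S \<subseteq> U\<close> by blast+
  moreover have "W \<subseteq> (subtopology X U) closure_of W'"
  proof -
    have "U \<inter> W' = W'" "W \<subseteq> U" using W \<open>S \<subseteq> U\<close> by blast+
    then show ?thesis using W(6) by (simp add: closure_of_subtopology)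
  qed
  moreover have "subtopology (subtopology X U) W' = subtopology X W'"
  proof -
    have "U \<inter> W' = W'" using W \<open>S \<subseteq> U\<close> by blast
    then show ?thesis by (simp add: subtopology_subtopology)
  qed
  ultimately show "\<exists>W W'. openin (subtopology X U) W \<and> openin (subtopology X U) W' \<and> x \<in> W \<and>
      W' \<subseteq> W \<and> W \<subseteq> S \<and> W \<subseteq> subtopology X U closure_of W' \<and>
      subtopology (subtopology X U) W' homeomorphic_space Euclidean_space d"
    using W(3-5,7) by (intro exI[of _ W] exI[of _ W'] conjI) simp_all
qed

text \<open>For a set \<open>C\<close> of dimension below \<open>n\<close>, the intersection with an open set need not be closed in
  Euclidean space of its own dimension; one additional dimension makes a closed embedding
  possible, and leaves the image a proper subset.\<close>
definition thin_in :: "nat \<Rightarrow> 'a topology \<Rightarrow> 'a set \<Rightarrow> bool" where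
  "thin_in n X C \<longleftrightarrow> closedin X C \<and> (\<forall>W. openin X W \<longrightarrow>
     (\<exists>T. closedin (Euclidean_space n) T \<and> T \<noteq> topspace (Euclidean_space n) \<and>
        subtopology X (C \<inter> W) homeomorphic_space subtopology (Euclidean_space n) T))"

text \<open>Since thinness quantifies over all open sets, an open subspace inherits it; this allows
  thin sets to be removed one after another.\<close>

lemma thin_in_open_subset:
  assumes "thin_in n X C" and "openin X U"
  shows "thin_in n (subtopology X U) (C \<inter> U)"
  unfolding thin_in_def
proof (intro conjI allI impI)
  show "closedin (subtopology X U) (C \<inter> U)"
    using assms by (auto simp: thin_in_def closedin_subtopology)
  fix W assume "openin (subtopology X U) W"
  then have W: "openin X W" "W \<subseteq> U" using assms(2) by (auto simp: openin_open_subtopology)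
  moreover have "subtopology (subtopology X U) (C \<inter> U \<inter> W) = subtopology X (C \<inter> W)"
    using W by (simp add: subtopology_subtopology) (metis Int_absorb1 Int_left_commute inf.idem inf_assoc inf_commute)
  ultimately show "\<exists>T. closedin (Euclidean_space n) T \<and> T \<noteq> topspace (Euclidean_space n) \<and>
      subtopology (subtopology X U) (C \<inter> U \<inter> W) homeomorphic_space subtopology (Euclidean_space n) T"
    using assms(1) by (simp add: thin_in_def)
qed

text \<open>The chart carries the part of \<open>C\<close> in \<open>W\<close> to a closed subset of
  Euclidean space that is homeomorphic to a proper closed subset one dimension lower. Its complement
  is pulled back along the inverse chart.\<close>

lemma connectedin_chart_minus_thin:
  assumes thin: "thin_in n X C" and W: "openin X W"
    and hom: "subtopology X W homeomorphic_space Euclidean_space (Suc n)"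
  shows "connectedin X (W - C)" and "W - C \<noteq> {}"
proof -
  have Wsub: "W \<subseteq> topspace X" using W openin_subset by blast
  obtain T where T: "closedin (Euclidean_space n) T" "T \<noteq> topspace (Euclidean_space n)"
      "subtopology X (C \<inter> W) homeomorphic_space subtopology (Euclidean_space n) T"
    using thin W unfolding thin_in_def by blast
  obtain f g where fg: "homeomorphic_maps (subtopology X W) (Euclidean_space (Suc n)) f g"
    using hom unfolding homeomorphic_space_def by blast
  then have f: "homeomorphic_map (subtopology X W) (Euclidean_space (Suc n)) f"
    and g: "homeomorphic_map (Euclidean_space (Suc n)) (subtopology X W) g"
    using homeomorphic_maps_map by blast+
  let ?S = "f ` (C \<inter> W)"
  have top: "topspace (subtopology X W) = W" using Wsub by auto
  have clo: "closedin (subtopology X W) (C \<inter> W)"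
    using thin by (auto simp: thin_in_def closedin_subtopology)
  then have S: "closedin (Euclidean_space (Suc n)) ?S"
    using homeomorphic_map_closedness_eq[OF f] by blast
  have "homeomorphic_map (subtopology (subtopology X W) (C \<inter> W)) (subtopology (Euclidean_space (Suc n)) ?S) f"
  proof (rule homeomorphic_map_subtopologies[OF f])
    show "f ` (topspace (subtopology X W) \<inter> (C \<inter> W)) = topspace (Euclidean_space (Suc n)) \<inter> ?S"
      using closedin_subset[OF S] top by (simp add: Int_absorb1)
  qed
  moreover have "subtopology (subtopology X W) (C \<inter> W) = subtopology X (C \<inter> W)"
    by (simp add: subtopology_subtopology Int_absorb1 Int_left_commute Int_commute)
  ultimately have "subtopology X (C \<inter> W) homeomorphic_space subtopology (Euclidean_space (Suc n)) ?S"
    using homeomorphic_map_imp_homeomorphic_space by force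
  then have hom': "subtopology (Euclidean_space (Suc n)) ?S homeomorphic_space subtopology (Euclidean_space n) T"
    using T(3) homeomorphic_space_trans homeomorphic_space_sym by blast
  have inj: "inj_on f W" using homeomorphic_imp_injective_map[OF f] top by simp
  have img: "f ` W = topspace (Euclidean_space (Suc n))" using homeomorphic_imp_surjective_map[OF f] top by simp
  have gf: "g (f x) = x" if "x \<in> W" for x
    using fg that top by (auto simp: homeomorphic_maps_def)
  have diff: "topspace (Euclidean_space (Suc n)) - ?S = f ` (W - C)"
    unfolding img[symmetric] using inj by (auto simp: inj_on_def)
  have "connectedin (subtopology X W) (g ` (f ` (W - C)))"
    using Euclidean_complement_of_lower_dimensional(1)[OF S T(1,2) hom'] diff
      homeomorphic_imp_continuous_map[OF g] connectedin_continuous_map_image by metis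
  moreover have "g ` (f ` (W - C)) = W - C" using gf by force
  ultimately show "connectedin X (W - C)" by (simp add: connectedin_subtopology)
  show "W - C \<noteq> {}"
    using Euclidean_complement_of_lower_dimensional(2)[OF S T(1,2) hom'] diff closedin_subset[OF S] by auto
qed

text \<open>A separation of the complement of \<open>C\<close> would extend to one of
  \<open>X\<close>: near each point the complement is connected and so lies on one side, and as
  \<open>C\<close> has empty interior the extended sides stay disjoint.\<close>

lemma connectedin_minus_thin:
  assumes X: "connected_space X" "dense_charts (Suc n) X" and thin: "thin_in n X C"
  shows "connectedin X (topspace X - C)"
proof -
  have C: "closedin X C" using thin by (simp add: thin_in_def)
  then have op: "openin X (topspace X - C)" by blast
  \<comment> \<open>\<open>C\<close> has empty interior: every nonempty open set contains a
    Euclidean chart, which \<open>C\<close> cannot fill.\<close>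
  have dense: "W - C \<noteq> {}" if W: "openin X W" "W \<noteq> {}" for W
  proof -
    obtain x where "x \<in> W" using W by blast
    then have "\<exists>V W'. openin X V \<and> openin X W' \<and> x \<in> V \<and> W' \<subseteq> V \<and> V \<subseteq> W \<and>
        V \<subseteq> X closure_of W' \<and> subtopology X W' homeomorphic_space Euclidean_space (Suc n)"
      using X(2) W(1) unfolding dense_charts_def by blast
    then obtain W' where "openin X W'" "W' \<subseteq> W"
        "subtopology X W' homeomorphic_space Euclidean_space (Suc n)"
      by (elim exE conjE) (rule that, auto)
    then show ?thesis using connectedin_chart_minus_thin(2)[OF thin] by blast
  qed
  \<comment> \<open>\<open>W' - C\<close> is connected and dense in \<open>W - C\<close>, and a set
    between a connected set and its closure is connected. This treats points that have no Euclidean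
    chart around them.\<close>
  have local: "\<exists>W. openin X W \<and> x \<in> W \<and> connectedin X (W - C)" if x: "x \<in> topspace X" for x
  proof -
    obtain W W' where W: "openin X W" "openin X W'" "x \<in> W" "W' \<subseteq> W" "W \<subseteq> X closure_of W'"
        "subtopology X W' homeomorphic_space Euclidean_space (Suc n)"
      using X(2) x openin_topspace[of X] unfolding dense_charts_def by meson
    have "connectedin X (W - C)"
    proof (rule connectedin_intermediate_closure_of)
      show "connectedin X (W' - C)" using connectedin_chart_minus_thin(1)[OF thin W(2,6)] .
      show "W' - C \<subseteq> W - C" using W by blast
      show "W - C \<subseteq> X closure_of (W' - C)"
      proof
        fix y assume y: "y \<in> W - C"
        have "\<exists>z. z \<in> W' - C \<and> z \<in> T" if T: "y \<in> T" "openin X T" for T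
        proof -
          \<comment> \<open>As \<open>C\<close> is closed, \<open>T - C\<close> is still a
            neighbourhood of \<open>y\<close> and therefore meets \<open>W'\<close>.\<close>
          have "openin X (T - C)" "y \<in> T - C" using y T C by blast+
          moreover have "y \<in> X closure_of W'" using y W(5) by blast
          ultimately obtain z where "z \<in> W'" "z \<in> T - C" unfolding in_closure_of by blast
          then show ?thesis by blast
        qed
        moreover have "y \<in> topspace X" using y W(1) openin_subset by blast
        ultimately show "y \<in> X closure_of (W' - C)" unfolding in_closure_of by blast
      qed
    qed
    then show ?thesis using W by blast
  qed
  have "connected_space (subtopology X (topspace X - C))"
    unfolding connected_space_def
  proof (intro notI, elim exE conjE)
    fix A B assume "openin (subtopology X (topspace X - C)) A" "openin (subtopology X (topspace X - C)) B"
      and cover: "topspace (subtopology X (topspace X - C)) \<subseteq> A \<union> B" and "A \<inter> B = {}" "A \<noteq> {}" "B \<noteq> {}"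
    then have A: "openin X A" "A \<inter> C = {}" and B: "openin X B" "B \<inter> C = {}"
      using op by (auto simp: openin_open_subtopology)
    have cover: "topspace X - C \<subseteq> A \<union> B" using cover by auto
    \<comment> \<open>Each open set meets the complement of \<open>C\<close>, so the two sides of a separation extend
      over \<open>C\<close> without overlapping.\<close>
    let ?ext = "\<lambda>A. \<Union>{W. openin X W \<and> W - C \<subseteq> A}"
    have "topspace X \<subseteq> ?ext A \<union> ?ext B"
    proof
      fix x assume "x \<in> topspace X"
      then obtain W where W: "openin X W" "x \<in> W" "connectedin X (W - C)" using local by blast
      then have "W - C \<subseteq> A \<union> B" using cover openin_subset by blast
      then have "W - C \<subseteq> A \<or> W - C \<subseteq> B"
        using connectedinD[OF W(3) A(1) B(1)] \<open>A \<inter> B = {}\<close> by blast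
      then show "x \<in> ?ext A \<union> ?ext B" using W by blast
    qed
    moreover have "?ext A \<inter> ?ext B = {}"
    proof (rule ccontr)
      assume "?ext A \<inter> ?ext B \<noteq> {}"
      then obtain V W where "openin X V" "V - C \<subseteq> A" "openin X W" "W - C \<subseteq> B" "V \<inter> W \<noteq> {}"
        by blast
      then show False using dense[of "V \<inter> W"] \<open>A \<inter> B = {}\<close> openin_Int[of X V W] by blast
    qed
    moreover have "openin X (?ext A)" "openin X (?ext B)" by (auto intro: openin_Union)
    moreover have "?ext A \<noteq> {}" "?ext B \<noteq> {}"
      using A(1) B(1) \<open>A \<noteq> {}\<close> \<open>B \<noteq> {}\<close> by blast+
    ultimately have "\<exists>U V. openin X U \<and> openin X V \<and> topspace X \<subseteq> U \<union> V \<and> U \<inter> V = {} \<and> U \<noteq> {} \<and> V \<noteq> {}"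
      by (intro exI[of _ "?ext A"] exI[of _ "?ext B"] conjI)
    then show False using X(1) unfolding connected_space_def by (rule notE[rotated])
  qed
  then show ?thesis by (simp add: connectedin_def)
qed

text \<open>Each removal leaves an open subspace, which is again connected, has dense charts and
  meets the remaining sets in thin sets.\<close>

lemma connectedin_minus_thin_Union:
  assumes "finite \<C>" and X: "connected_space X" "dense_charts (Suc n) X"
    and thin: "\<And>C. C \<in> \<C> \<Longrightarrow> thin_in n X C"
  shows "connectedin X (topspace X - \<Union>\<C>)"
  using assms(1) thin
proof (induction \<C> rule: finite_induct)
  case empty
  then show ?case using X by (simp add: connectedin_topspace)
next
  case (insert C \<C>)
  let ?U = "topspace X - \<Union>\<C>"
  have "closedin X (\<Union>\<C>)"
    using insert by (intro closedin_Union) (auto simp: thin_in_def)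
  then have U: "openin X ?U" by blast
  have "connectedin (subtopology X ?U) (topspace (subtopology X ?U) - C \<inter> ?U)"
  proof (rule connectedin_minus_thin)
    show "connected_space (subtopology X ?U)" using insert by (simp add: connectedin_def)
    show "dense_charts (Suc n) (subtopology X ?U)" using dense_charts_open_subset X U by blast
    show "thin_in n (subtopology X ?U) (C \<inter> ?U)" using thin_in_open_subset insert.prems U by blast
  qed
  moreover have "topspace (subtopology X ?U) - C \<inter> ?U = topspace X - \<Union>(insert C \<C>)" by auto
  ultimately show ?case by (simp add: connectedin_subtopology)
qed

section \<open>Charts of manifolds with boundary\<close>

lemma homeomorphic_open_interval_UNIV:
  fixes a b :: real
  assumes "a < b"
  shows "{a<..<b} homeomorphic (UNIV :: real set)"
proof -
  have "{a<..<b} = ball ((a + b) / 2) ((b - a) / 2)"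
    by (auto simp: dist_real_def abs_if field_simps split: if_splits)
  moreover have "ball ((a + b) / 2) ((b - a) / 2) homeomorphic (UNIV :: real set)"
    using homeomorphic_ball_UNIV[of "(b - a) / 2" "(a + b) / 2"] assms by simp
  ultimately show ?thesis by simp
qed

text \<open>Homeomorphisms of the intervals with the line are applied coordinatewise.\<close>

lemma homeomorphic_open_box_Euclidean_space:
  fixes a b :: "nat \<Rightarrow> real"
  assumes "\<And>i. i < d \<Longrightarrow> a i < b i"
  shows "top_of_set {z. (\<forall>i\<ge>d. z i = 0) \<and> (\<forall>i<d. a i < z i \<and> z i < b i)}
    homeomorphic_space Euclidean_space d"
proof -
  have "\<exists>f g. homeomorphism {a i<..<b i} (UNIV :: real set) f g" if "i < d" for i
    using homeomorphic_open_interval_UNIV[OF assms[OF that]] unfolding homeomorphic_def .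
  then obtain P Q where PQ: "\<And>i. i < d \<Longrightarrow> homeomorphism {a i<..<b i} (UNIV :: real set) (P i) (Q i)"
    by metis
  let ?S = "{z. (\<forall>i\<ge>d. z i = 0) \<and> (\<forall>i<d. a i < z i \<and> z i < b i)}"
  let ?T = "{z :: nat \<Rightarrow> real. \<forall>i\<ge>d. z i = 0}"
  let ?f = "\<lambda>z i. if i < d then P i (z i) else 0" and ?g = "\<lambda>z i. if i < d then Q i (z i) else 0"
  have P: "P i ` {a i<..<b i} = UNIV" "Q i ` UNIV = {a i<..<b i}"
    "continuous_on {a i<..<b i} (P i)" "continuous_on UNIV (Q i)"
    "\<And>x. x \<in> {a i<..<b i} \<Longrightarrow> Q i (P i x) = x" "\<And>x. P i (Q i x) = x" if "i < d" for i
    using PQ[OF that] by (auto simp: homeomorphism_def)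
  have Q: "a i < Q i x" "Q i x < b i" if "i < d" for i x
    using P(2)[OF that] by auto
  have "homeomorphism ?S ?T ?f ?g"
  proof (rule homeomorphismI)
    show "continuous_on ?S ?f"
    proof (rule continuous_on_coordinatewise_then_product)
      show "continuous_on ?S (\<lambda>z. ?f z i)" for i
      proof (cases "i < d")
        case True
        have "continuous_on ?S (\<lambda>z. P i (z i))"
          by (rule continuous_on_compose2[OF P(3)[OF True]]) (auto intro!: continuous_intros simp: True)
        then show ?thesis by (simp add: True)
      qed simp
    qed
    show "continuous_on ?T ?g"
    proof (rule continuous_on_coordinatewise_then_product)
      show "continuous_on ?T (\<lambda>z. ?g z i)" for i
      proof (cases "i < d")
        case True
        have "continuous_on ?T (\<lambda>z. Q i (z i))"
          by (rule continuous_on_compose2[OF P(4)[OF True]]) (auto intro!: continuous_intros)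
        then show ?thesis by (simp add: True)
      qed simp
    qed
    show "?f ` ?S \<subseteq> ?T" "?g ` ?T \<subseteq> ?S" using Q by auto
    show "?g (?f x) = x" if "x \<in> ?S" for x using that P(5) by (auto simp: fun_eq_iff)
    show "?f (?g x) = x" if "x \<in> ?T" for x using that P(6) by (auto simp: fun_eq_iff)
  qed
  then show ?thesis
    unfolding Euclidean_space_eq_top_of_set homeomorphic_space_iff_homeomorphic
    using homeomorphic_def by blast
qed

lemma half_space_eq_top_of_set: "half_space d = top_of_set {y. (\<forall>i\<ge>d. y i = 0) \<and> 0 \<le> y 0}"
  by (simp add: half_space_def Euclidean_space_eq_top_of_set subtopology_subtopology Collect_conj_eq)

text \<open>A basic open set of the product topology fits into \<open>U\<close>, and each of its
  factors contains an interval. The box restricts every coordinate, so it need not be open itself;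
  only its containment in \<open>U\<close> is claimed.\<close>

lemma open_fun_contains_box:
  fixes y :: "nat \<Rightarrow> real"
  assumes "open U" and "y \<in> U"
  obtains a b where "\<And>i. a i < y i" "\<And>i. y i < b i"
    "\<And>z. (\<forall>i. a i < z i \<and> z i < b i) \<Longrightarrow> z \<in> U"
proof -
  have "openin (product_topology (\<lambda>i. euclidean) UNIV) U"
    using assms by (simp add: euclidean_product_topology)
  then obtain X where X: "y \<in> (\<Pi>\<^sub>E i\<in>UNIV. X i)" "\<And>i. openin euclidean (X i)"
      "(\<Pi>\<^sub>E i\<in>UNIV. X i) \<subseteq> U"
    using product_topology_open_contains_basis[of "\<lambda>i. euclidean" UNIV U y] assms(2) by metis
  have "\<exists>e>0. \<forall>t. \<bar>t - y i\<bar> < e \<longrightarrow> t \<in> X i" for i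
  proof -
    have "open (X i)" using X(2) by simp
    moreover have "y i \<in> X i" using X(1) by (simp add: PiE_iff)
    ultimately obtain e where "e > 0" "\<And>t. dist t (y i) < e \<Longrightarrow> t \<in> X i"
      unfolding open_dist by blast
    then show ?thesis unfolding dist_real_def by blast
  qed
  then obtain e where e: "\<And>i. e i > 0" "\<And>i t. \<bar>t - y i\<bar> < e i \<Longrightarrow> t \<in> X i" by metis
  show ?thesis
  proof (rule that[of "\<lambda>i. y i - e i" "\<lambda>i. y i + e i"])
    fix z :: "nat \<Rightarrow> real" assume z: "\<forall>i. y i - e i < z i \<and> z i < y i + e i"
    have "\<bar>z i - y i\<bar> < e i" for i using z[rule_format, of i] by linarith
    then have "z \<in> (\<Pi>\<^sub>E i\<in>UNIV. X i)" using e(2) by (auto simp: PiE_iff)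
    then show "z \<in> U" using X by blast
  qed (use e in auto)
qed

text \<open>The neighbourhood is a small box cut with the half-space. Its part with positive
  coordinate 0 is a full open box, hence Euclidean, and it is dense because coordinate 0 can always
  be raised slightly.\<close>

lemma dense_charts_half_space:
  assumes "0 < d"
  shows "dense_charts d (half_space d)"
  unfolding dense_charts_def
proof (intro allI impI, elim conjE)
  fix S :: "(nat \<Rightarrow> real) set" and y assume "openin (half_space d) S" and "y \<in> S"
  let ?H = "{y :: nat \<Rightarrow> real. (\<forall>i\<ge>d. y i = 0) \<and> 0 \<le> y 0}"
  obtain U where U: "open U" "S = ?H \<inter> U"
    using \<open>openin (half_space d) S\<close> unfolding half_space_eq_top_of_set openin_open by blast
  then have y: "y \<in> U" "y \<in> ?H" using \<open>y \<in> S\<close> by auto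
  obtain a b where ab: "\<And>i. a i < y i" "\<And>i. y i < b i" "\<And>z. (\<forall>i. a i < z i \<and> z i < b i) \<Longrightarrow> z \<in> U"
    using open_fun_contains_box[OF U(1) y(1)] by metis
  \<comment> \<open>Only the first \<open>d\<close> coordinates are bounded, which keeps
    \<open>?B\<close> open; on the half-space the others vanish and so agree with those of
    \<open>y\<close>.\<close>
  let ?B = "{z :: nat \<Rightarrow> real. \<forall>i<d. a i < z i \<and> z i < b i}"
  have openB: "open ?B"
  proof -
    have "?B = (\<Inter>i\<in>{..<d}. {z. a i < z i} \<inter> {z. z i < b i})" by auto
    moreover have "open \<dots>"
      by (intro open_INT ballI open_Int open_Collect_less continuous_intros) auto
    ultimately show ?thesis by simp
  qed
  let ?W = "?H \<inter> ?B" and ?W' = "?H \<inter> (?B \<inter> {z. 0 < z 0})"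
  have "openin (half_space d) ?W"
    unfolding half_space_eq_top_of_set using openB by (rule openin_open_Int)
  moreover have "open (?B \<inter> {z. 0 < z 0})"
    by (intro open_Int openB open_Collect_less continuous_intros)
  then have "openin (half_space d) ?W'"
    unfolding half_space_eq_top_of_set by (rule openin_open_Int)
  moreover have "y \<in> ?W" using y ab by auto
  moreover have "?W' \<subseteq> ?W" by blast
  moreover have "?W \<subseteq> S"
  proof
    fix z assume z: "z \<in> ?W"
    have "a i < z i \<and> z i < b i" for i
    proof (cases "i < d")
      case False
      then have "z i = y i" using z y by simp
      then show ?thesis using ab by simp
    qed (use z in auto)
    then show "z \<in> S" using ab(3) z U by blast
  qed
  moreover have "?W \<subseteq> half_space d closure_of ?W'"
  proof
    fix z assume z: "z \<in> ?W"
    have "\<exists>w. w \<in> ?W' \<and> w \<in> T" if T: "z \<in> T" "openin (half_space d) T" for T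
    proof -
      obtain V where V: "open V" "T = ?H \<inter> V"
        using T(2) unfolding half_space_eq_top_of_set openin_open by blast
      have "continuous_on UNIV (\<lambda>t. z(0 := t))" by (rule continuous_on_fun_upd)
      then have "open ((\<lambda>t. z(0 := t)) -` V)" using V(1) by (simp add: open_vimage)
      moreover have "z 0 \<in> (\<lambda>t. z(0 := t)) -` V" using T V by simp
      ultimately obtain e where e: "e > 0" "\<And>t. \<bar>t - z 0\<bar> < e \<Longrightarrow> z(0 := t) \<in> V"
        unfolding open_dist dist_real_def by blast
      \<comment> \<open>The shift of coordinate 0 must stay within \<open>V\<close> and below the
        upper bound \<open>b 0\<close> of the box.\<close>
      obtain s where s: "0 < s" "s < e" "s < b 0 - z 0"
        using dense[of 0 "min e (b 0 - z 0)"] e z assms by auto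
      let ?w = "z(0 := z 0 + s)"
      have "?w \<in> V" using e(2) s by simp
      moreover have "?w \<in> ?H" using z s assms by auto
      moreover have "?w \<in> ?B" using z s by (auto simp: less_imp_le intro: less_trans)
      moreover have "0 < ?w 0" using z s by auto
      ultimately show ?thesis using V by blast
    qed
    moreover have "z \<in> topspace (half_space d)" using z by (simp add: half_space_eq_top_of_set)
    ultimately show "z \<in> half_space d closure_of ?W'" unfolding in_closure_of by blast
  qed
  moreover have "subtopology (half_space d) ?W' homeomorphic_space Euclidean_space d"
  proof -
    \<comment> \<open>The two lower bounds 0 and \<open>a 0\<close> for coordinate 0 merge into
      their maximum.\<close>
    let ?a = "a(0 := max 0 (a 0))"
    have *: "?W' = {z. (\<forall>i\<ge>d. z i = 0) \<and> (\<forall>i<d. ?a i < z i \<and> z i < b i)}"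
      using assms by (auto simp: less_imp_le) 
    have "?a i < b i" for i
      using ab(1,2)[of i] y by (auto intro: less_trans le_less_trans)
    then have "top_of_set ?W' homeomorphic_space Euclidean_space d"
      unfolding * by (rule homeomorphic_open_box_Euclidean_space)
    moreover have "subtopology (half_space d) ?W' = top_of_set ?W'"
      unfolding half_space_eq_top_of_set subtopology_subtopology by (simp add: Int_absorb1)
    ultimately show ?thesis by simp
  qed
  ultimately show "\<exists>W W'. openin (half_space d) W \<and> openin (half_space d) W' \<and> y \<in> W \<and> W' \<subseteq> W \<and>
      W \<subseteq> S \<and> W \<subseteq> half_space d closure_of W' \<and>
      subtopology (half_space d) W' homeomorphic_space Euclidean_space d"
    by (intro exI[of _ ?W] exI[of _ ?W'] conjI)
qed

lemma dense_charts_homeomorphic_space: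
  assumes X: "dense_charts d X" and "X homeomorphic_space Y"
  shows "dense_charts d Y"
  unfolding dense_charts_def
proof (intro allI impI, elim conjE)
  obtain f g where "homeomorphic_maps X Y f g"
    using assms(2) unfolding homeomorphic_space_def by blast
  then have f: "homeomorphic_map X Y f" and g: "homeomorphic_map Y X g"
    and fg: "\<And>y. y \<in> topspace Y \<Longrightarrow> f (g y) = y"
    by (auto simp: homeomorphic_maps_map)
  fix S y assume S: "openin Y S" and y: "y \<in> S"
  have Ssub: "S \<subseteq> topspace Y" using S openin_subset by blast
  have fgS: "f ` g ` S = S" using fg Ssub by force
  have "openin X (g ` S)" using homeomorphic_map_openness_eq[OF g] S by blast
  moreover have "g y \<in> g ` S" using y by blast
  ultimately obtain W W' where W: "openin X W" "openin X W'" "g y \<in> W" "W' \<subseteq> W" "W \<subseteq> g ` S"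
      "W \<subseteq> X closure_of W'" "subtopology X W' homeomorphic_space Euclidean_space d"
    using X unfolding dense_charts_def by meson
  have sub: "W \<subseteq> topspace X" "W' \<subseteq> topspace X" using W openin_subset by blast+
  have "openin Y (f ` W)" "openin Y (f ` W')"
    using homeomorphic_map_openness_eq[OF f] W by blast+
  moreover have "y \<in> f ` W" using W(3) fg y Ssub by (metis imageI subsetD)
  moreover have "f ` W' \<subseteq> f ` W" using W(4) by blast
  moreover have "f ` W \<subseteq> S" using W(5) fgS by blast
  moreover have "f ` W \<subseteq> Y closure_of f ` W'"
    using W(6) homeomorphic_map_closure_of[OF f sub(2)] by blast
  moreover have "subtopology Y (f ` W') homeomorphic_space Euclidean_space d"
  proof -
    have "f ` (topspace X \<inter> W') = topspace Y \<inter> f ` W'"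
      using sub(2) homeomorphic_imp_surjective_map[OF f] by auto
    then have "homeomorphic_map (subtopology X W') (subtopology Y (f ` W')) f"
      using homeomorphic_map_subtopologies[OF f] by blast
    then have "subtopology Y (f ` W') homeomorphic_space subtopology X W'"
      using homeomorphic_map_imp_homeomorphic_space homeomorphic_space_sym by blast
    then show ?thesis using W(7) homeomorphic_space_trans by blast
  qed
  ultimately show "\<exists>W W'. openin Y W \<and> openin Y W' \<and> y \<in> W \<and> W' \<subseteq> W \<and> W \<subseteq> S \<and>
      W \<subseteq> Y closure_of W' \<and> subtopology Y W' homeomorphic_space Euclidean_space d"
    by (intro exI[of _ "f ` W"] exI[of _ "f ` W'"] conjI)
qed

lemma dense_charts_local:
  assumes "\<And>x. x \<in> topspace X \<Longrightarrow> \<exists>U. openin X U \<and> x \<in> U \<and> dense_charts d (subtopology X U)"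
  shows "dense_charts d X"
  unfolding dense_charts_def
proof (intro allI impI, elim conjE)
  fix S x assume S: "openin X S" and x: "x \<in> S"
  then have "x \<in> topspace X" using openin_subset by blast
  then obtain U where U: "openin X U" "x \<in> U" "dense_charts d (subtopology X U)"
    using assms by blast
  have "openin (subtopology X U) (S \<inter> U)" using S by (rule openin_subtopology_Int)
  moreover have "x \<in> S \<inter> U" using x U by blast
  ultimately obtain W W' where W: "openin (subtopology X U) W" "openin (subtopology X U) W'" "x \<in> W"
      "W' \<subseteq> W" "W \<subseteq> S \<inter> U" "W \<subseteq> subtopology X U closure_of W'"
      "subtopology (subtopology X U) W' homeomorphic_space Euclidean_space d"
    using U(3) unfolding dense_charts_def by meson
  have UW: "U \<inter> W' = W'" using W by blast
  have "openin X W" "openin X W'" using W(1,2) openin_open_subtopology[OF U(1)] by auto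
  moreover have "W \<subseteq> X closure_of W'"
    using W(6) UW by (auto simp: closure_of_subtopology)
  moreover have "subtopology X W' homeomorphic_space Euclidean_space d"
    using W(7) UW by (simp add: subtopology_subtopology)
  moreover have "W \<subseteq> S" using W(5) by blast
  ultimately show "\<exists>W W'. openin X W \<and> openin X W' \<and> x \<in> W \<and> W' \<subseteq> W \<and> W \<subseteq> S \<and>
      W \<subseteq> X closure_of W' \<and> subtopology X W' homeomorphic_space Euclidean_space d"
    using W(3,4) by (intro exI[of _ W] exI[of _ W'] conjI)
qed

lemma dense_charts_manifold_with_boundary:
  assumes "manifold_with_boundary d X" and "0 < d"
  shows "dense_charts d X"
proof (rule dense_charts_local)
  fix x assume "x \<in> topspace X"
  then obtain U V where UV: "openin X U" "x \<in> U" "openin (half_space d) V"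
      "subtopology X U homeomorphic_space subtopology (half_space d) V"
    using assms(1) unfolding manifold_with_boundary_def by meson
  have "dense_charts d (subtopology (half_space d) V)"
    using dense_charts_half_space[OF assms(2)] UV(3) by (rule dense_charts_open_subset)
  then have "dense_charts d (subtopology X U)"
    using UV(4) dense_charts_homeomorphic_space homeomorphic_space_sym by blast
  then show "\<exists>U. openin X U \<and> x \<in> U \<and> dense_charts d (subtopology X U)" using UV by blast
qed

section \<open>Geometric simplices\<close>

definition gsimplex :: "'v set \<Rightarrow> ('v \<Rightarrow> real) set" where
  "gsimplex \<sigma> = {x. (\<forall>v. 0 \<le> x v) \<and> (\<forall>v. v \<notin> \<sigma> \<longrightarrow> x v = 0) \<and> sum x \<sigma> = 1}"

lemma realization_eq_Union: "realization K = \<Union>(gsimplex ` K)"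
  by (auto simp: realization_def gsimplex_def)

lemma realization_top_eq_top_of_set: "realization_top K = top_of_set (realization K)"
  by (simp add: realization_top_def euclidean_product_topology)

lemma closed_gsimplex: "closed (gsimplex \<sigma>)"
proof -
  have "gsimplex \<sigma> = (\<Inter>v. {x. 0 \<le> x v}) \<inter> (\<Inter>v\<in>-\<sigma>. {x. x v = 0}) \<inter> {x. sum x \<sigma> = 1}"
    by (auto simp: gsimplex_def)
  moreover have "closed \<dots>"
    by (intro closed_Int closed_INT ballI closed_Collect_le closed_Collect_eq continuous_intros)
  ultimately show ?thesis by simp
qed

lemma gsimplex_mono: 
  assumes "finite \<tau>" "\<sigma> \<subseteq> \<tau>"
  shows "gsimplex \<sigma> \<subseteq> gsimplex \<tau>"
proof
  fix x assume x: "x \<in> gsimplex \<sigma>"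
  have "sum x \<tau> = sum x \<sigma>"
    by (rule sum.mono_neutral_right) (use assms x in \<open>auto simp: gsimplex_def\<close>)
  then show "x \<in> gsimplex \<tau>" using x assms by (auto simp: gsimplex_def)
qed

lemma gsimplex_Int:
  assumes "finite \<sigma>"
  shows "gsimplex \<sigma> \<inter> gsimplex \<tau> \<subseteq> gsimplex (\<sigma> \<inter> \<tau>)"
proof
  fix x assume x: "x \<in> gsimplex \<sigma> \<inter> gsimplex \<tau>"
  have "sum x \<sigma> = sum x (\<sigma> \<inter> \<tau>)"
    by (rule sum.mono_neutral_right) (use assms x in \<open>auto simp: gsimplex_def\<close>)
  then show "x \<in> gsimplex (\<sigma> \<inter> \<tau>)" using x by (auto simp: gsimplex_def)
qed

lemma gsimplex_empty [simp]: "gsimplex {} = {}"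
  by (simp add: gsimplex_def)

lemma gsimplex_positive_point:
  assumes "finite \<sigma>" "\<sigma> \<noteq> {}"
  obtains x where "x \<in> gsimplex \<sigma>" "\<And>v. v \<in> \<sigma> \<Longrightarrow> 0 < x v"
proof -
  \<comment> \<open>The barycentre of the simplex.\<close>
  let ?x = "\<lambda>v. if v \<in> \<sigma> then 1 / real (card \<sigma>) else 0"
  have pos: "0 < card \<sigma>" using assms by (simp add: card_gt_0_iff)
  have "?x \<in> gsimplex \<sigma>" using pos assms by (auto simp: gsimplex_def)
  then show ?thesis using that[of ?x] pos by auto
qed

lemma gsimplex_positive_subset:
  assumes "x \<in> gsimplex \<tau>" and "\<And>v. v \<in> \<sigma> \<Longrightarrow> 0 < x v"
  shows "\<sigma> \<subseteq> \<tau>"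
proof (rule subsetI, rule ccontr)
  fix v assume "v \<in> \<sigma>" "v \<notin> \<tau>"
  have "x v = 0" using assms(1) \<open>v \<notin> \<tau>\<close> by (simp add: gsimplex_def)
  then show False using assms(2)[OF \<open>v \<in> \<sigma>\<close>] by simp
qed

text \<open>A simplex with \<open>m\<close> vertices is the standard simplex in the hyperplane of
  coordinate sum 1 of \<open>m\<close>-space. This leaves the radial direction free: stretching
  along rays by a factor that tends to infinity towards the complement of \<open>W\<close> turns the
  relatively open part into a closed set, which avoids the origin.\<close>

lemma thin_in_gsimplex:
  assumes "finite \<sigma>" and "card \<sigma> \<le> n" and sub: "gsimplex \<sigma> \<subseteq> R"
  shows "thin_in n (top_of_set R) (gsimplex \<sigma>)"
  unfolding thin_in_def
proof (intro conjI allI impI)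
  show "closedin (top_of_set R) (gsimplex \<sigma>)"
    using sub closed_gsimplex by (rule closed_subset)
  fix W assume "openin (top_of_set R) W"
  then obtain Q where Q: "open Q" "W = R \<inter> Q" unfolding openin_open by blast
  then have CW: "gsimplex \<sigma> \<inter> W = gsimplex \<sigma> \<inter> Q" using sub by blast
  define m where "m = card \<sigma>"
  obtain h where h: "bij_betw h {..<m} \<sigma>"
    using ex_bij_betw_nat_finite[OF assms(1)] by (auto simp: m_def lessThan_atLeast0)
  define k where "k = inv_into {..<m} h"
  have hk: "h i \<in> \<sigma>" "k (h i) = i" if "i < m" for i
    using h that by (auto simp: k_def bij_betw_def)
  have kh: "k v < m" "h (k v) = v" if "v \<in> \<sigma>" for v
    using h that unfolding k_def
    by (metis bij_betw_def inv_into_into lessThan_iff) (metis bij_betw_inv_into_right h that)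
  have sum_eq: "sum x \<sigma> = (\<Sum>i<m. x (h i))" for x :: "_ \<Rightarrow> real"
    using sum.reindex_bij_betw[OF h, of x] by simp
  \<comment> \<open>\<open>e\<close> and \<open>r\<close> transport coordinates along the numbering
    \<open>h\<close> of the vertices; they are inverse to each other between the simplex and the
    standard simplex \<open>P\<close>.\<close>
  define e :: "('a \<Rightarrow> real) \<Rightarrow> nat \<Rightarrow> real" where "e x = (\<lambda>i. if i < m then x (h i) else 0)" for x
  define r :: "(nat \<Rightarrow> real) \<Rightarrow> 'a \<Rightarrow> real" where "r y = (\<lambda>v. if v \<in> \<sigma> then y (k v) else 0)" for y
  define P where "P = {y :: nat \<Rightarrow> real. (\<forall>i. 0 \<le> y i) \<and> (\<forall>i\<ge>m. y i = 0) \<and> (\<Sum>i<m. y i) = 1}"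
  have eP: "e x \<in> P" and re: "r (e x) = x" if "x \<in> gsimplex \<sigma>" for x
    using that hk kh by (auto simp: e_def r_def P_def gsimplex_def sum_eq fun_eq_iff)
  have rP: "r y \<in> gsimplex \<sigma>" and er: "e (r y) = y" if "y \<in> P" for y
    using that hk kh by (auto simp: e_def r_def P_def gsimplex_def sum_eq fun_eq_iff)
  have conte: "continuous_on S e" for S
  proof (rule continuous_on_coordinatewise_then_product)
    show "continuous_on S (\<lambda>x. e x i)" for i
      by (cases "i < m") (auto simp: e_def intro!: continuous_intros)
  qed
  have contr: "continuous_on S r" for S
  proof (rule continuous_on_coordinatewise_then_product)
    show "continuous_on S (\<lambda>y. r y v)" for v
      by (cases "v \<in> \<sigma>") (auto simp: r_def intro!: continuous_intros)
  qed
  have closedP: "closed P"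
  proof -
    have "P = (\<Inter>i. {y. 0 \<le> y i}) \<inter> (\<Inter>i\<in>{m..}. {y. y i = 0}) \<inter> {y. (\<Sum>i<m. y i) = 1}"
      by (auto simp: P_def)
    moreover have "closed \<dots>"
      by (intro closed_Int closed_INT ballI closed_Collect_le closed_Collect_eq continuous_intros)
    ultimately show ?thesis by simp
  qed
  \<comment> \<open>The origin is not in \<open>P\<close>; it only serves to make the set nonempty, as \<open>infdist\<close> to the
    empty set is 0.\<close>
  define F where "F = insert (\<lambda>_. 0) (P \<inter> r -` (- Q))"
  have closedF: "closed F"
    unfolding F_def using Q(1)
    by (intro closed_insert continuous_closed_preimage[OF contr closedP] closed_Compl)
  \<comment> \<open>On \<open>P\<close>, \<open>\<phi>\<close> is positive over \<open>Q\<close> and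
    zero elsewhere. The cap at 1 makes the stretching factor \<open>1 / \<phi> y\<close> at least
    1.\<close>
  define \<phi> where "\<phi> y = min 1 (infdist y F)" for y
  have cont\<phi>: "continuous_on S \<phi>" for S
    unfolding \<phi>_def by (intro continuous_intros)
  have zero: "(\<lambda>_. 0) \<notin> P" by (simp add: P_def)
  have \<phi>pos: "0 < \<phi> y" if "y \<in> P" "r y \<in> Q" for y
  proof -
    have "y \<notin> F" using that zero by (auto simp: F_def)
    then have "infdist y F \<noteq> 0"
      using in_closed_iff_infdist_zero[OF closedF, of y] by (auto simp: F_def)
    then show ?thesis using infdist_nonneg[of y F] by (simp add: \<phi>_def)
  qed
  have \<phi>zero: "\<phi> y = 0" if "y \<in> P" "r y \<notin> Q" for y
    using that by (simp add: \<phi>_def F_def)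
  have \<phi>le: "\<phi> y \<le> 1" for y by (simp add: \<phi>_def)
  \<comment> \<open>Points of \<open>P\<close> have coordinate sum 1, so \<open>s\<close> reads off
    the stretching factor and \<open>q\<close> projects radially back to \<open>P\<close>. On
    \<open>A\<close> the divisor is at least 1.\<close>
  define s where "s z = (\<Sum>i<m. z i)" for z :: "nat \<Rightarrow> real"
  define q where "q z = (\<lambda>i. z i / s z)" for z :: "nat \<Rightarrow> real"
  define A where "A = {z :: nat \<Rightarrow> real. (\<forall>i. 0 \<le> z i) \<and> (\<forall>i\<ge>m. z i = 0) \<and> 1 \<le> s z}"
  have closedA: "closed A"
  proof -
    have "A = (\<Inter>i. {y. 0 \<le> y i}) \<inter> (\<Inter>i\<in>{m..}. {y. y i = 0}) \<inter> {y. 1 \<le> (\<Sum>i<m. y i)}"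
      by (auto simp: A_def s_def)
    moreover have "closed \<dots>"
      by (intro closed_Int closed_INT ballI closed_Collect_le closed_Collect_eq continuous_intros)
    ultimately show ?thesis by simp
  qed
  have conts: "continuous_on S s" for S unfolding s_def by (intro continuous_intros)
  have contq: "continuous_on A q"
  proof (rule continuous_on_coordinatewise_then_product)
    show "continuous_on A (\<lambda>z. q z i)" for i
      unfolding q_def
    proof (rule continuous_on_divide[OF _ conts])
      show "continuous_on A (\<lambda>z. z i)" by (intro continuous_intros)
      show "\<forall>z\<in>A. s z \<noteq> 0" unfolding A_def by auto
    qed
  qed
  have qP: "q z \<in> P" if "z \<in> A" for z
    using that by (auto simp: q_def P_def A_def s_def simp flip: sum_divide_distrib)
  \<comment> \<open>Points of \<open>P\<close> are pushed along their rays to infinity as they approach the complement of \<open>Q\<close>.\<close>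
  define T where "T = {z \<in> A. s z * \<phi> (q z) = 1}"
  \<comment> \<open>The defining equation is continuous on the closed set \<open>A\<close>. It fails
    wherever \<open>\<phi> (q z)\<close> is 0, so no point over the complement of \<open>Q\<close>
    occurs in \<open>T\<close>.\<close>
  have closedT: "closed T"
    unfolding T_def
    by (intro continuous_closed_preimage_constant closedA continuous_on_mult conts
        continuous_on_compose2[OF cont\<phi> contq, of UNIV]) simp
  define f where "f x = (\<lambda>i. e x i / \<phi> (e x))" for x
  define g where "g z = r (q z)" for z
  have "homeomorphism (gsimplex \<sigma> \<inter> Q) T f g"
  proof (rule homeomorphismI)
    have \<phi>e: "0 < \<phi> (e x)" if "x \<in> gsimplex \<sigma> \<inter> Q" for x
      using that eP re \<phi>pos by auto
    have sf: "s (f x) = 1 / \<phi> (e x)" and qf: "q (f x) = e x" if "x \<in> gsimplex \<sigma> \<inter> Q" for x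
    proof -
      show sf: "s (f x) = 1 / \<phi> (e x)"
        using eP[of x] that by (simp add: s_def f_def P_def flip: sum_divide_distrib)
      show "q (f x) = e x" using \<phi>e[OF that] by (simp add: q_def sf) (simp add: f_def)
    qed
    show "continuous_on (gsimplex \<sigma> \<inter> Q) f"
    proof (rule continuous_on_coordinatewise_then_product)
      show "continuous_on (gsimplex \<sigma> \<inter> Q) (\<lambda>x. f x i)" for i
        unfolding f_def
      proof (rule continuous_on_divide)
        show "continuous_on (gsimplex \<sigma> \<inter> Q) (\<lambda>x. e x i)"
          using conte by (rule continuous_on_product_then_coordinatewise)
        show "continuous_on (gsimplex \<sigma> \<inter> Q) (\<lambda>x. \<phi> (e x))"
          by (rule continuous_on_compose2[OF cont\<phi>[of UNIV] conte]) simp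
        show "\<forall>x\<in>gsimplex \<sigma> \<inter> Q. \<phi> (e x) \<noteq> 0" using \<phi>e by (metis less_irrefl)
      qed
    qed
    show "continuous_on T g"
      unfolding g_def
      by (rule continuous_on_compose2[OF contr[of UNIV] continuous_on_subset[OF contq]])
        (auto simp: T_def)
    show "f ` (gsimplex \<sigma> \<inter> Q) \<subseteq> T"
    proof clarify
      fix x assume "x \<in> gsimplex \<sigma>" "x \<in> Q"
      then have x: "x \<in> gsimplex \<sigma> \<inter> Q" by simp
      have "e x \<in> P" using eP x by blast
      then have "f x \<in> A"
        using \<phi>e[OF x] \<phi>le[of "e x"] sf[OF x] by (auto simp: A_def P_def f_def)
      then show "f x \<in> T" using sf[OF x] qf[OF x] \<phi>e[OF x] by (simp add: T_def)
    qed
    have rq: "r (q z) \<in> Q" if "z \<in> T" for z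
      using that by (cases "r (q z) \<in> Q") (auto simp: T_def \<phi>zero qP)
    show "g ` T \<subseteq> gsimplex \<sigma> \<inter> Q"
      using rq rP[OF qP] by (auto simp: g_def T_def)
    show "g (f x) = x" if "x \<in> gsimplex \<sigma> \<inter> Q" for x
      using that qf re by (simp add: g_def)
    show "f (g z) = z" if "z \<in> T" for z
    proof -
      have "e (g z) = q z" using that er[OF qP] by (simp add: g_def T_def)
      moreover have "s z * \<phi> (q z) = 1" using that by (simp add: T_def)
      ultimately show ?thesis by (simp add: f_def) (simp add: q_def)
    qed
  qed
  then have "gsimplex \<sigma> \<inter> Q homeomorphic T" unfolding homeomorphic_def by blast
  moreover have Tsub: "T \<subseteq> {x. \<forall>i\<ge>n. x i = 0}"
    using assms(2) by (auto simp: T_def A_def m_def)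
  moreover have "R \<inter> (gsimplex \<sigma> \<inter> W) = gsimplex \<sigma> \<inter> Q" using CW sub by blast
  ultimately have "subtopology (top_of_set R) (gsimplex \<sigma> \<inter> W) homeomorphic_space
      subtopology (Euclidean_space n) T"
    by (simp add: Euclidean_space_eq_top_of_set subtopology_subtopology Int_absorb1)
  moreover have "closedin (Euclidean_space n) T"
    using closedT Tsub by (simp add: closedin_Euclidean_space_iff topspace_Euclidean_space)
  \<comment> \<open>The coordinate sum is at least 1 on \<open>T\<close>, so the origin shows that
    \<open>T\<close> is a proper subset.\<close>
  moreover have "(\<lambda>_. 0) \<in> topspace (Euclidean_space n)" "(\<lambda>_. 0) \<notin> T"
    by (auto simp: topspace_Euclidean_space T_def A_def s_def)
  ultimately show "\<exists>T. closedin (Euclidean_space n) T \<and> T \<noteq> topspace (Euclidean_space n) \<and>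
      subtopology (top_of_set R) (gsimplex \<sigma> \<inter> W) homeomorphic_space subtopology (Euclidean_space n) T"
    by blast
qed

section \<open>Purity: maximal simplices are facets\<close>

text \<open>If \<open>b < a\<close>, invariance of domain would make the image open in dimension
  \<open>a\<close>, although it lies in the hyperplane where coordinate \<open>b\<close> vanishes. A
  small move in that coordinate gives the contradiction.\<close>

lemma Euclidean_space_embedding_dimension_le:
  assumes U: "openin (Euclidean_space a) U" "U \<noteq> {}"
    and f: "continuous_map (subtopology (Euclidean_space a) U) (Euclidean_space b) f" "inj_on f U"
  shows "a \<le> b"
proof (rule ccontr)
  assume "\<not> a \<le> b"
  then have "topspace (Euclidean_space b) \<subseteq> topspace (Euclidean_space a)" by simp
  then have "continuous_map (subtopology (Euclidean_space a) U) (Euclidean_space a) f"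
    using f(1) unfolding cm_Euclidean_space_iff_continuous_on by blast
  then have "openin (Euclidean_space a) (f ` U)"
    using invariance_of_domain_Euclidean_space U(1) f(2) by blast
  then obtain Q where Q: "open Q" "f ` U = {x. \<forall>i\<ge>a. x i = 0} \<inter> Q"
    unfolding Euclidean_space_eq_top_of_set openin_open by blast
  have sub: "f ` U \<subseteq> {x. \<forall>i\<ge>b. x i = 0}"
    using continuous_map_image_subset_topspace[OF f(1)] openin_subset[OF U(1)]
    by (auto simp: topspace_Euclidean_space)
  obtain y where y: "y \<in> f ` U" using U(2) by blast
  have "continuous_on UNIV (\<lambda>t. y(b := t))" by (rule continuous_on_fun_upd)
  then have "open ((\<lambda>t. y(b := t)) -` Q)" using Q(1) by (simp add: open_vimage)
  moreover have "y b \<in> (\<lambda>t. y(b := t)) -` Q" using y Q by simp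
  ultimately obtain e where e: "e > 0" "\<And>t. dist t (y b) < e \<Longrightarrow> y(b := t) \<in> Q"
    unfolding open_dist by blast
  have "y(b := y b + e / 2) \<in> f ` U"
    using e y \<open>\<not> a \<le> b\<close> unfolding Q(2) by (auto simp: dist_real_def)
  then have "(y(b := y b + e / 2)) b = 0" "y b = 0" using sub y by blast+
  then show False using e(1) by simp
qed

text \<open>The relative interior of a maximal simplex is open in the realization, so it contains an
  open set homeomorphic to \<open>d\<close>-space. With \<open>m\<close> the dimension of the
  simplex, embeddings in both directions give \<open>d = m\<close>.\<close>

lemma card_maximal_simplex:
  assumes K: "simplicial_complex K" and charts: "dense_charts d (realization_top K)"
    and \<sigma>: "\<sigma> \<in> K" "\<And>\<tau>. \<lbrakk>\<tau> \<in> K; \<sigma> \<subseteq> \<tau>\<rbrakk> \<Longrightarrow> \<tau> = \<sigma>"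
  shows "card \<sigma> = d + 1"
proof -
  have fin: "finite \<sigma>" "\<sigma> \<noteq> {}" using K \<sigma>(1) by (auto simp: simplicial_complex_def)
  then obtain m where m: "card \<sigma> = Suc m" by (metis card_0_eq not0_implies_Suc)
  obtain h where h: "bij_betw h {..<Suc m} \<sigma>"
    using ex_bij_betw_nat_finite[OF fin(1)] m by (auto simp: lessThan_atLeast0)
  define k where "k = inv_into {..<Suc m} h"
  have hk: "h i \<in> \<sigma>" "k (h i) = i" if "i < Suc m" for i
    using h that by (auto simp: k_def bij_betw_def)
  have kh: "k v < Suc m" "h (k v) = v" if "v \<in> \<sigma>" for v
    using h that unfolding k_def
    by (metis bij_betw_def inv_into_into lessThan_iff) (metis bij_betw_inv_into_right h that)
  have sum_eq: "sum x \<sigma> = (\<Sum>i<m. x (h i)) + x (h m)" for x :: "_ \<Rightarrow> real"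
    using sum.reindex_bij_betw[OF h, of x] by simp
  \<comment> \<open>\<open>e\<close> drops the last barycentric coordinate, which leaves
    \<open>m\<close> free ones; \<open>r\<close> recovers it as 1 minus the sum of the
    others.\<close>
  define e :: "('a \<Rightarrow> real) \<Rightarrow> nat \<Rightarrow> real" where "e x = (\<lambda>i. if i < m then x (h i) else 0)" for x
  define r :: "(nat \<Rightarrow> real) \<Rightarrow> 'a \<Rightarrow> real" where
    "r y = (\<lambda>v. if v \<in> \<sigma> then if k v = m then 1 - (\<Sum>i<m. y i) else y (k v) else 0)" for y
  have re: "r (e x) = x" if "x \<in> gsimplex \<sigma>" for x
  proof
    fix v show "r (e x) v = x v"
      using that kh[of v] by (auto simp: r_def e_def gsimplex_def sum_eq)
  qed
  have er: "e (r y) = y" if "\<forall>i\<ge>m. y i = 0" for y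
    using that hk by (auto simp: r_def e_def fun_eq_iff)
  have conte: "continuous_on S e" for S
  proof (rule continuous_on_coordinatewise_then_product)
    show "continuous_on S (\<lambda>x. e x i)" for i
      by (cases "i < m") (auto simp: e_def intro!: continuous_intros)
  qed
  have contr: "continuous_on S r" for S
  proof (rule continuous_on_coordinatewise_then_product)
    fix v
    consider "v \<notin> \<sigma>" | "v \<in> \<sigma>" "k v = m" | "v \<in> \<sigma>" "k v \<noteq> m" by blast
    then show "continuous_on S (\<lambda>y. r y v)"
    proof cases
      case 2
      have "continuous_on S (\<lambda>y. 1 - (\<Sum>i<m. y i))" by (intro continuous_intros)
      then show ?thesis using 2 by (simp add: r_def)
    qed (auto simp: r_def intro!: continuous_intros)
  qed
  let ?D = "realization K \<inter> {x. \<forall>v\<in>\<sigma>. 0 < x v}"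
  have "{x :: 'a \<Rightarrow> real. \<forall>v\<in>\<sigma>. 0 < x v} = (\<Inter>v\<in>\<sigma>. {x. 0 < x v})" by auto
  moreover have "open (\<Inter>v\<in>\<sigma>. {x :: 'a \<Rightarrow> real. 0 < x v})"
    using fin by (intro open_INT ballI open_Collect_less continuous_intros)
  ultimately have openD: "openin (realization_top K) ?D"
    unfolding realization_top_eq_top_of_set by (simp add: openin_open_Int)
  \<comment> \<open>A simplex carrying a point that is positive on all of \<sigma> contains
    \<sigma>, and so equals it by maximality.\<close>
  have Dsub: "?D \<subseteq> gsimplex \<sigma>"
  proof
    fix x assume x: "x \<in> ?D"
    then obtain \<tau> where \<tau>: "\<tau> \<in> K" "x \<in> gsimplex \<tau>" by (auto simp: realization_eq_Union)
    then have "\<sigma> \<subseteq> \<tau>" using gsimplex_positive_subset x by blast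
    then show "x \<in> gsimplex \<sigma>" using \<sigma>(2) \<tau> by blast
  qed
  obtain p where "p \<in> gsimplex \<sigma>" "\<And>v. v \<in> \<sigma> \<Longrightarrow> 0 < p v"
    using gsimplex_positive_point fin by metis
  then have "p \<in> ?D" using \<sigma>(1) by (auto simp: realization_eq_Union)
  then obtain V W where "openin (realization_top K) W" "W \<subseteq> V" "V \<subseteq> ?D"
      and hom: "subtopology (realization_top K) W homeomorphic_space Euclidean_space d"
    using charts openD unfolding dense_charts_def by meson
  then have WD: "W \<subseteq> ?D" and W: "W \<subseteq> realization K" by blast+
  obtain Q where Q: "open Q" "W = realization K \<inter> Q"
    using \<open>openin (realization_top K) W\<close> unfolding realization_top_eq_top_of_set openin_open by blast
  have topW: "subtopology (realization_top K) W = top_of_set W"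
    using W by (simp add: realization_top_eq_top_of_set subtopology_subtopology Int_absorb1)
  let ?E = "{x :: nat \<Rightarrow> real. \<forall>i\<ge>d. x i = 0}"
  have "W homeomorphic ?E"
    using hom topW by (simp add: Euclidean_space_eq_top_of_set)
  then obtain f g where fg: "homeomorphism W ?E f g"
    unfolding homeomorphic_def by blast
  have f: "continuous_on W f" "f ` W = ?E" "inj_on f W"
    and g: "continuous_on ?E g" "g ` ?E = W" "inj_on g ?E"
    using fg unfolding homeomorphism_def by (blast | metis inj_on_inverseI)+
  have "d \<le> m"
  proof (rule Euclidean_space_embedding_dimension_le)
    show "openin (Euclidean_space d) (topspace (Euclidean_space d))" by simp
    show "topspace (Euclidean_space d) \<noteq> {}" by (auto simp: topspace_Euclidean_space)
    have "inj_on e W" using re WD Dsub by (metis (no_types, lifting) inj_on_inverseI subsetD)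
    then show "inj_on (e \<circ> g) (topspace (Euclidean_space d))"
      using g by (simp add: comp_inj_on topspace_Euclidean_space)
    have "continuous_on ?E (e \<circ> g)" using g(1) conte by (rule continuous_on_compose)
    then show "continuous_map (subtopology (Euclidean_space d) (topspace (Euclidean_space d))) (Euclidean_space m) (e \<circ> g)"
      unfolding cm_Euclidean_space_iff_continuous_on
      by (auto simp: topspace_Euclidean_space e_def)
  qed
  moreover have "m \<le> d"
  proof (rule Euclidean_space_embedding_dimension_le)
    \<comment> \<open>On \<open>?U\<close> all barycentric coordinates of \<open>r y\<close> are
      positive, so \<open>r\<close> maps this open subset of \<open>m\<close>-space into
      \<open>W\<close>, and \<open>f \<circ> r\<close> embeds it in \<open>d\<close>-space.\<close>
    let ?P = "(\<Inter>i\<in>{..<m}. {y. 0 < y i}) \<inter> {y :: nat \<Rightarrow> real. (\<Sum>i<m. y i) < 1} \<inter> r -` Q"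
    let ?U = "{y. \<forall>i\<ge>m. y i = 0} \<inter> ?P"
    have "open ?P"
      by (intro open_Int open_INT ballI open_Collect_less open_vimage[OF Q(1) contr] continuous_intros)
        simp
    then show "openin (Euclidean_space m) ?U"
      unfolding Euclidean_space_eq_top_of_set by (rule openin_open_Int)
    have rU: "r y \<in> W" if "y \<in> ?U" for y
    proof -
      have "r y \<in> gsimplex \<sigma>"
      proof -
        have "0 \<le> r y v" for v using that kh[of v] by (auto simp: r_def less_Suc_eq intro: less_imp_le)
        moreover have "sum (r y) \<sigma> = 1" using hk by (simp add: sum_eq) (simp add: r_def)
        ultimately show ?thesis by (simp add: gsimplex_def r_def)
      qed
      then show ?thesis using that \<sigma>(1) Q by (auto simp: realization_eq_Union)
    qed
    have "W \<noteq> {}" using g(2) by auto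
    then obtain x where x: "x \<in> W" by blast
    then have xs: "x \<in> gsimplex \<sigma>" "\<And>v. v \<in> \<sigma> \<Longrightarrow> 0 < x v" "x \<in> Q" using WD Dsub Q by auto
    have "(\<Sum>i<m. x (h i)) < 1" using xs(1) xs(2)[OF hk(1)[of m]] by (simp add: gsimplex_def sum_eq)
    then have "e x \<in> ?U" using xs hk re[OF xs(1)] by (auto simp: e_def)
    then show "?U \<noteq> {}" by blast
    have "inj_on r ?U" using er by (intro inj_on_inverseI[of _ e]) auto
    then show "inj_on (f \<circ> r) ?U"
      using f(3) rU by (intro comp_inj_on) (auto intro: inj_on_subset)
    have "continuous_on ?U (f \<circ> r)"
      using rU by (intro continuous_on_compose contr continuous_on_subset[OF f(1)]) auto
    moreover have "f (r y) \<in> ?E" if "y \<in> ?U" for y using f(2) rU[OF that] by blast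
    ultimately show "continuous_map (subtopology (Euclidean_space m) ?U) (Euclidean_space d) (f \<circ> r)"
      unfolding cm_Euclidean_space_iff_continuous_on
      by (auto simp: topspace_Euclidean_space elim: continuous_on_subset)
  qed
  ultimately show ?thesis using m by simp
qed

lemma simplex_subset_facet:
  assumes K: "simplicial_complex K" and charts: "dense_charts d (realization_top K)" and "\<sigma> \<in> K"
  obtains \<tau> where "\<tau> \<in> facets d K" "\<sigma> \<subseteq> \<tau>"
proof -
  have "finite K" using K by (simp add: simplicial_complex_def)
  then obtain \<tau> where \<tau>: "\<tau> \<in> K" "\<sigma> \<subseteq> \<tau>" "\<forall>\<rho>\<in>K. \<tau> \<subseteq> \<rho> \<longrightarrow> \<tau> = \<rho>"
    using finite_has_maximal2[of K \<sigma>] \<open>\<sigma> \<in> K\<close> by auto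
  then have "card \<tau> = d + 1" using card_maximal_simplex[OF K charts] by blast
  then show ?thesis using that \<tau> by (auto simp: facets_def)
qed

section \<open>Strong connectivity of the facets\<close>

text \<open>Otherwise the union of the facets in \<open>G\<close> and the union of the remaining
  ones are closed sets that meet only in simplices of dimension at most \<open>d - 2\<close>.
  Removing all such simplices leaves a connected set, which the two closed sets would
  separate.\<close>

lemma facets_strongly_connected:
  assumes K: "simplicial_complex K" and charts: "dense_charts d (realization_top K)"
    and conn: "connected_space (realization_top K)" and "0 < d"
    and G: "G \<subseteq> facets d K" "G \<noteq> {}" "G \<noteq> facets d K"
  shows "\<exists>f\<in>G. \<exists>g\<in>facets d K - G. d \<le> card (f \<inter> g)"
proof (rule ccontr)
  assume contra: "\<not> ?thesis"
  have finK: "finite K" and fin: "\<And>\<sigma>. \<sigma> \<in> K \<Longrightarrow> finite \<sigma>"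
    using K by (auto simp: simplicial_complex_def)
  obtain n where n: "d = Suc n" using \<open>0 < d\<close> gr0_implies_Suc by blast
  \<comment> \<open>At most \<open>n = d - 1\<close> vertices means codimension at least 2, and is
    the bound under which simplices are thin.\<close>
  let ?L = "{\<tau> \<in> K. card \<tau> \<le> n}"
  let ?M = "realization K - \<Union>(gsimplex ` ?L)"
  have "connectedin (realization_top K) (topspace (realization_top K) - \<Union>(gsimplex ` ?L))"
  proof (rule connectedin_minus_thin_Union)
    show "finite (gsimplex ` ?L)" using finK by simp
    show "dense_charts (Suc n) (realization_top K)" using charts n by simp
    fix C assume "C \<in> gsimplex ` ?L"
    then obtain \<tau> where \<tau>: "\<tau> \<in> K" "card \<tau> \<le> n" "C = gsimplex \<tau>" by blast
    then have "gsimplex \<tau> \<subseteq> realization K" by (auto simp: realization_eq_Union)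
    then show "thin_in n (realization_top K) C"
      using thin_in_gsimplex[OF fin] \<tau> by (simp add: realization_top_eq_top_of_set)
  qed (rule conn)
  then have conM: "connected ?M"
    by (simp add: realization_top_eq_top_of_set connectedin_subtopology)
  let ?A = "\<Union>(gsimplex ` G)" and ?B = "\<Union>(gsimplex ` (facets d K - G))"
  have FK: "facets d K \<subseteq> K" by (auto simp: facets_def)
  then have finF: "finite (facets d K)" using finK finite_subset by blast
  have clo: "closed ?A" "closed ?B"
    using finF G(1) finite_subset by (auto intro!: closed_UN closed_gsimplex)
  have cover: "?M \<subseteq> ?A \<union> ?B"
  proof
    fix x assume "x \<in> ?M"
    then obtain \<sigma> where \<sigma>: "\<sigma> \<in> K" "x \<in> gsimplex \<sigma>" by (auto simp: realization_eq_Union)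
    obtain \<tau> where \<tau>: "\<tau> \<in> facets d K" "\<sigma> \<subseteq> \<tau>" using simplex_subset_facet[OF K charts \<sigma>(1)] .
    then have "x \<in> gsimplex \<tau>" using gsimplex_mono[of \<tau> \<sigma>] fin FK \<sigma> by blast
    then show "x \<in> ?A \<union> ?B" using \<tau> by blast
  qed
  have disj: "?A \<inter> ?B \<inter> ?M = {}"
  proof (rule ccontr)
    assume "?A \<inter> ?B \<inter> ?M \<noteq> {}"
    then obtain x f g where x: "x \<in> ?M" "x \<in> gsimplex f" "x \<in> gsimplex g" "f \<in> G" "g \<in> facets d K - G"
      by blast
    have "f \<in> K" using x(4) G(1) FK by blast
    have "\<not> d \<le> card (f \<inter> g)" using contra x(4,5) by blast
    then have "card (f \<inter> g) \<le> n" using n by simp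
    have "x \<in> gsimplex (f \<inter> g)" using gsimplex_Int[of f g] fin \<open>f \<in> K\<close> x by blast
    then have "f \<inter> g \<noteq> {}" by auto
    then have "f \<inter> g \<in> K" using K \<open>f \<in> K\<close> unfolding simplicial_complex_def by blast
    then show False using x(1) \<open>x \<in> gsimplex (f \<inter> g)\<close> \<open>card (f \<inter> g) \<le> n\<close> by blast
  qed
  \<comment> \<open>A point positive at all \<open>d + 1\<close> vertices of a facet lies in no
    simplex with fewer vertices, so it survives the removal.\<close>
  have meets: "\<exists>x. x \<in> gsimplex f \<and> x \<in> ?M" if f: "f \<in> facets d K" for f
  proof -
    have "f \<in> K" "card f = d + 1" using f by (auto simp: facets_def)
    moreover have "f \<noteq> {}" using \<open>card f = d + 1\<close> by auto
    ultimately obtain x where x: "x \<in> gsimplex f" "\<And>v. v \<in> f \<Longrightarrow> 0 < x v"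
      using gsimplex_positive_point[of f] fin by metis
    have "x \<notin> gsimplex \<tau>" if \<tau>: "\<tau> \<in> ?L" for \<tau>
    proof
      assume "x \<in> gsimplex \<tau>"
      then have "f \<subseteq> \<tau>" using gsimplex_positive_subset x(2) by blast
      then have "card f \<le> card \<tau>" using \<tau> fin by (simp add: card_mono)
      then show False using \<tau> \<open>card f = d + 1\<close> n by simp
    qed
    then show ?thesis using x(1) \<open>f \<in> K\<close> by (auto simp: realization_eq_Union)
  qed
  have "?A \<inter> ?M \<noteq> {}" "?B \<inter> ?M \<noteq> {}" using G meets by blast+
  then have "\<exists>A B. closed A \<and> closed B \<and> ?M \<subseteq> A \<union> B \<and> A \<inter> B \<inter> ?M = {} \<and> A \<inter> ?M \<noteq> {} \<and> B \<inter> ?M \<noteq> {}"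
    using clo cover disj by (intro exI[of _ ?A] exI[of _ ?B] conjI)
  then show False using conM unfolding connected_closed by (rule notE[rotated])
qed

section \<open>Facet cycles\<close>

text \<open>A pair \<open>(f, v)\<close> records a facet and the vertex through which it is left; it
  is entered through the vertex of the preceding pair, or through \<open>u\<close>. The condition
  \<open>u \<noteq> v\<close> makes the two arcs at \<open>f\<close> distinct.\<close>

fun facet_trail :: "'v \<Rightarrow> ('v set \<times> 'v) list \<Rightarrow> 'v \<Rightarrow> bool" where
  "facet_trail u [] w \<longleftrightarrow> u = w"
| "facet_trail u ((f, v) # ps) w \<longleftrightarrow> u \<in> f \<and> v \<in> f \<and> u \<noteq> v \<and> facet_trail v ps w"

lemma facet_trail_append:
  "facet_trail u (ps @ qs) w \<longleftrightarrow> (\<exists>m. facet_trail u ps m \<and> facet_trail m qs w)"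
  by (induction u ps w rule: facet_trail.induct) auto

lemma facet_trail_nth:
  assumes "facet_trail u ps w" and "i < length ps"
  shows "(u # map snd ps) ! i \<in> fst (ps ! i) \<and> snd (ps ! i) \<in> fst (ps ! i)
    \<and> (u # map snd ps) ! i \<noteq> snd (ps ! i)"
  using assms
proof (induction u ps w arbitrary: i rule: facet_trail.induct)
  case (2 u f v ps w)
  then show ?case by (cases i) auto
qed simp

lemma facet_trail_last: "facet_trail u ps w \<Longrightarrow> (u # map snd ps) ! length ps = w"
  by (induction u ps w rule: facet_trail.induct) auto

text \<open>Arcs at different facets differ in the facet, and the two arcs at one facet differ in
  the vertex, so distinctness of the facets rules out repeated arcs.\<close>

lemma facet_cycle_if_closed_facet_trail:
  assumes K: "simplicial_complex K"
    and trail: "facet_trail u ps u" and "distinct (map fst ps)"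
    and fs: "set (map fst ps) = facets d K" and "ps \<noteq> []"
  shows "facet_cycle d K (u # map snd ps) (map fst ps)"
proof -
  have vertex: "v \<in> cvertices K" if "v \<in> f" "f \<in> facets d K" for v f
  proof -
    have "{v} \<subseteq> f" "f \<in> K" using that by (auto simp: facets_def)
    then have "{v} \<in> K" using K unfolding simplicial_complex_def by blast
    then show ?thesis by (simp add: cvertices_def)
  qed
  have mem: "fst (ps ! i) \<in> facets d K" if "i < length ps" for i
    using imageI[OF nth_mem[OF that], of fst] fs[symmetric] by simp
  have vs: "set (u # map snd ps) \<subseteq> cvertices K"
  proof
    fix v assume "v \<in> set (u # map snd ps)"
    then consider "v = u" | "v \<in> snd ` set ps" by auto
    then show "v \<in> cvertices K"
    proof cases
      case 1
      then show ?thesis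
        using facet_trail_nth[OF trail, of 0] mem[of 0] vertex[of u "fst (ps ! 0)"] \<open>ps \<noteq> []\<close> by simp
    next
      case 2
      then obtain i where "i < length ps" "v = snd (ps ! i)"
        unfolding image_iff Bex_def in_set_conv_nth by blast
      then show ?thesis using facet_trail_nth[OF trail] mem vertex by blast
    qed
  qed
  \<comment> \<open>The bound \<open>n\<close> is kept apart from the length of \<open>fs\<close>,
    so that the induction runs over initial segments of fixed lists.\<close>
  have "distinct (concat (map (\<lambda>i. [(vs ! i, fs ! i), (vs ! (i+1), fs ! i)]) [0..<n]))"
    if "n \<le> length fs" "distinct fs" "\<And>i. i < length fs \<Longrightarrow> vs ! i \<noteq> vs ! (i+1)"
    for n and vs :: "'a list" and fs :: "'a set list"
    using that
  proof (induction n)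
    case (Suc n)
    have "fs ! i \<noteq> fs ! n" if "i < n" for i
      using Suc.prems(1,2) that by (simp add: nth_eq_iff_index_eq)
    note ne = this this[symmetric]
    have "vs ! n \<noteq> vs ! (n+1)" using Suc.prems(1,3) by simp
    then show ?case using Suc.IH[OF _ Suc.prems(2,3)] Suc.prems(1) by (auto simp: ne)
  qed simp
  from this[of "length ps" "map fst ps" "u # map snd ps"]
  have "distinct (concat (map (\<lambda>i. [((u # map snd ps) ! i, map fst ps ! i),
      ((u # map snd ps) ! (i+1), map fst ps ! i)]) [0..<length (map fst ps)]))"
    using facet_trail_nth[OF trail] assms(3) by simp
  then show ?thesis
    unfolding facet_cycle_def
    using vs facet_trail_nth[OF trail] facet_trail_last[OF trail] assms(3) fs by simp
qed

lemma card_ge_2_obtain: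
  assumes "2 \<le> card A"
  obtains a b where "a \<in> A" "b \<in> A" "a \<noteq> b"
proof -
  obtain B where "B \<subseteq> A" "card B = 2" using assms obtain_subset_with_card_n by metis
  then show ?thesis using that by (auto simp: card_2_iff)
qed

text \<open>The facet \<open>g\<close> omits only one vertex of \<open>f\<close>, so the passage \<open>a, f, b\<close> can be replaced by
  \<open>a, f, c, g, b\<close> or by \<open>a, g, c, f, b\<close>.\<close>
lemma facet_trail_insert:
  assumes trail: "facet_trail u ps u" and fin: "finite f" "finite g"
    and f: "f \<in> set (map fst ps)" "g \<notin> set (map fst ps)" and "distinct (map fst ps)"
    and card: "card f = Suc d" "d \<le> card (f \<inter> g)" "3 \<le> d"
  obtains qs where "facet_trail u qs u" "distinct (map fst qs)"
    "set (map fst qs) = insert g (set (map fst ps))"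
proof -
  obtain xs b ys where ps: "ps = xs @ (f, b) # ys"
    using f by (force simp: in_set_conv_decomp)
  obtain a where a: "facet_trail u xs a" "facet_trail a ((f, b) # ys) u"
    using trail unfolding ps facet_trail_append by blast
  have "card {a, b} \<le> 2" by (simp add: card_insert_if)
  \<comment> \<open>The intersection has at least three elements, so one remains besides
    \<open>a\<close> and \<open>b\<close>.\<close>
  then have "card (f \<inter> g - {a, b}) > 0"
    using diff_card_le_card_Diff[of "{a, b}" "f \<inter> g"] card by fastforce
  then obtain c where c: "c \<in> f" "c \<in> g" "c \<noteq> a" "c \<noteq> b" 
    by (auto simp: card_gt_0_iff)
  have "a \<in> g \<or> b \<in> g"
  proof (rule ccontr)
    assume "\<not> ?thesis"
    \<comment> \<open>If \<open>g\<close> missed both vertices, the intersection would have at most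
      \<open>d - 1\<close> elements.\<close>
    then have "f \<inter> g \<subseteq> f - {a, b}" by auto
    then have "card (f \<inter> g) \<le> card (f - {a, b})" by (simp add: card_mono fin)
    also have "\<dots> = card f - 2" using a by (subst card_Diff_subset) auto
    finally show False using card by linarith
  qed
  then show ?thesis
  proof
    assume "a \<in> g"
    then show ?thesis
      using a c assms by (intro that[of "xs @ (g, c) # (f, b) # ys"])
        (auto simp: facet_trail_append ps)
  next
    assume "b \<in> g"
    then show ?thesis
      using a c assms by (intro that[of "xs @ (f, c) # (g, b) # ys"])
        (auto simp: facet_trail_append ps)
  qed
qed

text \<open>As long as the trail does not use all of \<open>F\<close>, \<open>adj\<close> supplies a
  new facet adjacent to one already traversed, which is then inserted. The induction starts with two
  facets because a single facet, entered and left through different vertices, gives no closed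
  trail.\<close>

lemma closed_facet_trail_exists:
  assumes fin: "finite F" "\<And>f. f \<in> F \<Longrightarrow> finite f" and card: "\<And>f. f \<in> F \<Longrightarrow> card f = Suc d"
    and "3 \<le> d"
    and f0: "f\<^sub>0 \<in> F" "F \<noteq> {f\<^sub>0}"
    and adj: "\<And>G. \<lbrakk>G \<subseteq> F; G \<noteq> {}; G \<noteq> F\<rbrakk> \<Longrightarrow> \<exists>f\<in>G. \<exists>g\<in>F - G. d \<le> card (f \<inter> g)"
  shows "\<exists>u ps. facet_trail u ps u \<and> distinct (map fst ps) \<and> set (map fst ps) = F"
proof -
  have *: "\<exists>u ps. facet_trail u ps u \<and> distinct (map fst ps) \<and> set (map fst ps) \<subseteq> F
      \<and> card (set (map fst ps)) = k" if "2 \<le> k" "k \<le> card F" for k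
    using that
  proof (induction k rule: dec_induct)
    case base
    obtain g where g: "g \<in> F - {f\<^sub>0}" "d \<le> card (f\<^sub>0 \<inter> g)"
      using adj[of "{f\<^sub>0}"] f0 by auto
    \<comment> \<open>Two common vertices give the closed trail
      \<open>a, f\<^sub>0, b, g, a\<close>.\<close>
    obtain a b where "a \<in> f\<^sub>0 \<inter> g" "b \<in> f\<^sub>0 \<inter> g" "a \<noteq> b"
      using card_ge_2_obtain[of "f\<^sub>0 \<inter> g"] g \<open>3 \<le> d\<close> by force
    then show ?case
      using g f0 by (intro exI[of _ a] exI[of _ "[(f\<^sub>0, b), (g, a)]"]) (auto simp: card_insert_if)
  next
    case (step k)
    then obtain u ps where ps: "facet_trail u ps u" "distinct (map fst ps)"
      "set (map fst ps) \<subseteq> F" "card (set (map fst ps)) = k" by auto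
    moreover have "set (map fst ps) \<noteq> F" "set (map fst ps) \<noteq> {}"
      using ps(4) step.hyps step.prems by (metis Suc_n_not_le_n, metis card.empty not_numeral_le_zero)
    ultimately obtain f g where fg: "f \<in> set (map fst ps)" "g \<in> F" "g \<notin> set (map fst ps)"
      "d \<le> card (f \<inter> g)" using adj[of "set (map fst ps)"] by blast
    obtain qs where "facet_trail u qs u" "distinct (map fst qs)"
      "set (map fst qs) = insert g (set (map fst ps))"
      using facet_trail_insert[OF ps(1) _ _ fg(1,3) ps(2) _ fg(4) \<open>3 \<le> d\<close>] fin card fg ps(3)
      by (metis subsetD)
    then show ?case using ps(3,4) fg(2,3) by (intro exI[of _ u] exI[of _ qs]) (simp del: set_map)
  qed
  have "card F \<noteq> 1" using f0 card_1_singletonE by blast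
  moreover have "card F > 0" using fin f0 card_gt_0_iff by blast
  ultimately have "2 \<le> card F" by linarith
  with *[of "card F"] show ?thesis
    using card_subset_eq fin(1) by (metis order_refl)
qed

theorem theorem7:
  fixes K :: "'v set set" and d :: nat
  assumes "d \<ge> 3"
    and "simplicial_manifold d K"
    and "K \<noteq> {}"
    and "connected_space (realization_top K)"
    and "\<not> single_simplex d K"
  shows "\<exists>vs fs. facet_cycle d K vs fs"
proof -
  have K: "simplicial_complex K" and "manifold_with_boundary d (realization_top K)"
    using assms(2) by (auto simp: simplicial_manifold_def)
  then have charts: "dense_charts d (realization_top K)"
    using assms(1) by (intro dense_charts_manifold_with_boundary) auto
  have FK: "facets d K \<subseteq> K" by (auto simp: facets_def)
  have fin: "finite (facets d K)" "\<And>f. f \<in> facets d K \<Longrightarrow> finite f"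
    using K FK finite_subset by (auto simp: simplicial_complex_def)
  obtain \<sigma> where "\<sigma> \<in> K" using assms(3) by blast
  then obtain f where f: "f \<in> facets d K" using simplex_subset_facet[OF K charts] by blast
  \<comment> \<open>With a single facet every simplex would be a face of it, and \<open>K\<close>
    would be the excluded single simplex.\<close>
  have "facets d K \<noteq> {f}"
  proof
    assume single: "facets d K = {f}"
    have "\<tau> \<subseteq> f \<and> \<tau> \<noteq> {}" if "\<tau> \<in> K" for \<tau>
      using simplex_subset_facet[OF K charts that] single K that by (auto simp: simplicial_complex_def)
    moreover have "\<tau> \<in> K" if "\<tau> \<subseteq> f" "\<tau> \<noteq> {}" for \<tau>
      using K f FK that unfolding simplicial_complex_def by blast
    ultimately have "K = {\<tau>. \<tau> \<subseteq> f \<and> \<tau> \<noteq> {}}" by blast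
    moreover have "card f = d + 1" using f by (simp add: facets_def)
    ultimately show False using assms(5) fin(2)[OF f] unfolding single_simplex_def by blast
  qed
  moreover have "card g = Suc d" if "g \<in> facets d K" for g using that by (simp add: facets_def)
  moreover have "\<exists>f\<in>G. \<exists>g\<in>facets d K - G. d \<le> card (f \<inter> g)"
    if "G \<subseteq> facets d K" "G \<noteq> {}" "G \<noteq> facets d K" for G
    using facets_strongly_connected[OF K charts assms(4) _ that] assms(1) by simp
  ultimately obtain u ps where ps: "facet_trail u ps u" "distinct (map fst ps)"
      "set (map fst ps) = facets d K"
    using closed_facet_trail_exists[OF fin _ assms(1) f] by blast
  moreover have "ps \<noteq> []" using ps(3) f by auto
  ultimately show ?thesis using facet_cycle_if_closed_facet_trail[OF K] by blast
qed

end
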